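(* Let $(X,d)$ be a complete $b$-metric space, let $\varphi:[0,\infty)\to[0,\infty)$ be a comparison function, and let $f:X\to X$ be a $\varphi$-contraction, i.e. $d(f(x),f(y))\le\varphi(d(x,y))$ for all $x,y\in X$. Then $f$ is a Picard operator.
   Context: Given a nonempty set $X$ and a real number $s\in[1,\infty)$, a function $d:X\times X\to[0,\infty)$ is a $b$-metric (with constant $s$) if for all $x,y,z\in X$: (i) $d(x,y)=0$ if and only if $x=y$; (ii) $d(x,y)=d(y,x)$; (iii) $d(x,y)\le s(d(x,z)+d(z,y))$. The pair $(X,d)$ is then called a $b$-metric space (with constant $s$). The function $d$ is not assumed to be continuous. A sequence $(x_n)$ in $X$ is convergent if there is $l\in X$ with $\lim_{n\to\infty}d(x_n,l)=0$ (then $(x_n)$ converges to $l$); it is Cauchy if for every $\varepsilon>0$ there is $n_\varepsilon$ with $d(x_m,x_n)<\varepsilon$ for all $m,n\ge n_\varepsilon$. The space $(X,d)$ is complete if every Cauchy sequence is convergent. For a self-map $g$ of a set and $n\in\mathbb{N}$, $g^{[n]}$ denotes the $n$-fold composition of $g$ with itself ($g^{[0]}=\mathrm{id}$). A comparison function is a function $\varphi:[0,\infty)\to[0,\infty)$ that is increasing (in the weak sense: $r\le t$ implies $\varphi(r)\le\varphi(t)$) and satisfies $\lim_{n\to\infty}\varphi^{[n]}(r)=0$ for every $r\in[0,\infty)$. A function $f:X\to X$ is a Picard operator if there is a unique fixed point $\alpha$ of $f$ and, for every $x\in X$, the sequence $(f^{[n]}(x))_{n\in\mathbb{N}}$ converges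 to $\alpha$. *)

theory Defs
  imports "HOL-Analysis.Analysis"
begin

text \<open>
  Spaces are given by a carrier set \<open>X\<close>; the functions \<open>d\<close> and \<open>f\<close>
  are total in HOL, and only their values on \<open>X\<close> matter.
  Likewise \<open>{0..}\<close> represents \<open>[0, \<infinity>)\<close> as domain and codomain of \<open>\<phi>\<close>.
\<close>

definition b_metric_space :: "'a set \<Rightarrow> ('a \<Rightarrow> 'a \<Rightarrow> real) \<Rightarrow> real \<Rightarrow> bool" where
  "b_metric_space X d s \<longleftrightarrow>
     X \<noteq> {} \<and> 1 \<le> s \<and>
     (\<forall>x\<in>X. \<forall>y\<in>X. 0 \<le> d x y) \<and>
     (\<forall>x\<in>X. \<forall>y\<in>X. d x y = 0 \<longleftrightarrow> x = y) \<and>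
     (\<forall>x\<in>X. \<forall>y\<in>X. d x y = d y x) \<and>
     (\<forall>x\<in>X. \<forall>y\<in>X. \<forall>z\<in>X. d x y \<le> s * (d x z + d z y))"

definition b_converges_to :: "'a set \<Rightarrow> ('a \<Rightarrow> 'a \<Rightarrow> real) \<Rightarrow> (nat \<Rightarrow> 'a) \<Rightarrow> 'a \<Rightarrow> bool" where
  "b_converges_to X d x l \<longleftrightarrow> l \<in> X \<and> (\<lambda>n. d (x n) l) \<longlonglongrightarrow> 0"

definition b_Cauchy :: "('a \<Rightarrow> 'a \<Rightarrow> real) \<Rightarrow> (nat \<Rightarrow> 'a) \<Rightarrow> bool" where
  "b_Cauchy d x \<longleftrightarrow> (\<forall>\<epsilon>>0. \<exists>N. \<forall>m\<ge>N. \<forall>n\<ge>N. d (x m) (x n) < \<epsilon>)"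

definition b_complete :: "'a set \<Rightarrow> ('a \<Rightarrow> 'a \<Rightarrow> real) \<Rightarrow> bool" where
  "b_complete X d \<longleftrightarrow>
     (\<forall>x. (\<forall>n. x n \<in> X) \<longrightarrow> b_Cauchy d x \<longrightarrow> (\<exists>l. b_converges_to X d x l))"

definition comparison_function :: "(real \<Rightarrow> real) \<Rightarrow> bool" where
  "comparison_function \<phi> \<longleftrightarrow>
     \<phi> \<in> {0..} \<rightarrow> {0..} \<and> mono_on {0..} \<phi> \<and>
     (\<forall>r\<ge>0. (\<lambda>n. (\<phi> ^^ n) r) \<longlonglongrightarrow> 0)"

definition phi_contraction ::
  "'a set \<Rightarrow> ('a \<Rightarrow> 'a \<Rightarrow> real) \<Rightarrow> (real \<Rightarrow> real) \<Rightarrow> ('a \<Rightarrow> 'a) \<Rightarrow> bool" where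
  "phi_contraction X d \<phi> f \<longleftrightarrow> (\<forall>x\<in>X. \<forall>y\<in>X. d (f x) (f y) \<le> \<phi> (d x y))"

definition Picard_operator :: "'a set \<Rightarrow> ('a \<Rightarrow> 'a \<Rightarrow> real) \<Rightarrow> ('a \<Rightarrow> 'a) \<Rightarrow> bool" where
  "Picard_operator X d f \<longleftrightarrow>
     (\<exists>\<alpha>\<in>X. f \<alpha> = \<alpha> \<and> (\<forall>\<beta>\<in>X. f \<beta> = \<beta> \<longrightarrow> \<beta> = \<alpha>) \<and>
        (\<forall>x\<in>X. b_converges_to X d (\<lambda>n. (f ^^ n) x) \<alpha>))"

end

theory Submission
  imports Defs
begin

text \<open>
  Iterates of any two points approach each other, so it suffices to show that one orbit
  \<open>y\<^sub>k = f\<^sup>k x\<close> is Cauchy. Given \<open>\<epsilon>\<close>, choose \<open>n\<close> with \<open>\<phi>\<^sup>n \<epsilon> < \<epsilon> / (2s)\<close>. Once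
  \<open>d y\<^sub>K y\<^sub>K\<^sub>+\<^sub>n < \<epsilon> / (2s)\<close>, the map \<open>f\<^sup>n\<close> sends the \<open>\<epsilon>\<close>-ball around \<open>y\<^sub>K\<close> into itself, so this ball
  contains the whole tail of the orbit as soon as it contains \<open>y\<^sub>K, \<dots>, y\<^sub>K\<^sub>+\<^sub>n\<^sub>-\<^sub>1\<close>.
  Passing to \<open>f\<^sup>n\<close> compensates for the factor \<open>s\<close> in the triangle inequality.
\<close>

lemma b_metric_spaceD:
  assumes "b_metric_space X d s"
  shows "X \<noteq> {}" and "1 \<le> s"
    and "\<lbrakk>x \<in> X; y \<in> X\<rbrakk> \<Longrightarrow> 0 \<le> d x y"
    and "\<lbrakk>x \<in> X; y \<in> X\<rbrakk> \<Longrightarrow> d x y = 0 \<longleftrightarrow> x = y"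
    and "\<lbrakk>x \<in> X; y \<in> X\<rbrakk> \<Longrightarrow> d x y = d y x"
    and "\<lbrakk>x \<in> X; y \<in> X; z \<in> X\<rbrakk> \<Longrightarrow> d x y \<le> s * (d x z + d z y)"
  by (insert assms, unfold b_metric_space_def) metis+

lemma comparison_function_mono:
  assumes "comparison_function \<phi>" "0 \<le> a" "a \<le> b"
  shows "\<phi> a \<le> \<phi> b"
  using assms mono_onD[of "{0..}" \<phi> a b] unfolding comparison_function_def by simp

lemma comparison_function_funpow_nonneg:
  assumes "comparison_function \<phi>" "0 \<le> r"
  shows "0 \<le> (\<phi> ^^ n) r"
  using assms unfolding comparison_function_def by (induction n) (auto simp: Pi_iff)

lemma comparison_function_funpow_mono:
  assumes "comparison_function \<phi>" "0 \<le> a" "a \<le> b"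
  shows "(\<phi> ^^ n) a \<le> (\<phi> ^^ n) b"
proof (induction n)
  case (Suc n)
  then show ?case
    using comparison_function_mono[OF assms(1)]
      comparison_function_funpow_nonneg[OF assms(1,2)] by simp
qed (use assms in simp)

lemma comparison_function_funpow_tendsto:
  assumes "comparison_function \<phi>" "0 \<le> r"
  shows "(\<lambda>n. (\<phi> ^^ n) r) \<longlonglongrightarrow> 0"
  using assms unfolding comparison_function_def by blast

text \<open>If \<open>t < \<phi> t\<close>, monotonicity keeps all later iterates above
  \<open>\<phi> t > 0\<close>, so they cannot tend to 0. This makes every \<phi>-contraction
  nonexpansive.\<close>

lemma comparison_function_le:
  assumes "comparison_function \<phi>" "0 \<le> t"
  shows "\<phi> t \<le> t"
proof (rule ccontr)
  assume "\<not> \<phi> t \<le> t"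
  then have less: "t < \<phi> t" by simp
  have lower: "\<phi> t \<le> (\<phi> ^^ Suc n) t" for n
  proof (induction n)
    case (Suc n)
    then show ?case
      using comparison_function_mono[OF assms, of "(\<phi> ^^ Suc n) t"] less by simp
  qed simp
  have "(\<lambda>n. (\<phi> ^^ Suc n) t) \<longlonglongrightarrow> 0"
    using comparison_function_funpow_tendsto[OF assms] by (rule LIMSEQ_Suc)
  then have "\<phi> t \<le> 0"
    by (rule LIMSEQ_le_const) (use lower in blast)
  then show False using less assms(2) by simp
qed

lemma funpow_mem:
  assumes "f \<in> X \<rightarrow> X" "x \<in> X"
  shows "(f ^^ n) x \<in> X"
  using assms by (induction n) auto

lemma phi_contraction_funpow:
  assumes "b_metric_space X d s" "comparison_function \<phi>"
    and "f \<in> X \<rightarrow> X" "phi_contraction X d \<phi> f" and "x \<in> X" "y \<in> X"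
  shows "d ((f ^^ n) x) ((f ^^ n) y) \<le> (\<phi> ^^ n) (d x y)"
proof (induction n)
  case (Suc n)
  have mem: "(f ^^ n) x \<in> X" "(f ^^ n) y \<in> X"
    using assms by (auto intro: funpow_mem)
  have "d ((f ^^ Suc n) x) ((f ^^ Suc n) y) \<le> \<phi> (d ((f ^^ n) x) ((f ^^ n) y))"
    using assms(4) mem unfolding phi_contraction_def by simp
  also have "\<dots> \<le> \<phi> ((\<phi> ^^ n) (d x y))"
    using comparison_function_mono[OF assms(2)] b_metric_spaceD(3)[OF assms(1) mem] Suc by blast
  finally show ?case by simp
qed simp

text \<open>Used twice: with \<open>y\<close> on the orbit of \<open>x\<close>, to make gaps of
  fixed length vanish, and with \<open>y\<close> a fixed point, to obtain convergence of every
  orbit.\<close>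

lemma phi_contraction_funpow_tendsto:
  assumes "b_metric_space X d s" "comparison_function \<phi>"
    and "f \<in> X \<rightarrow> X" "phi_contraction X d \<phi> f" and "x \<in> X" "y \<in> X"
  shows "(\<lambda>n. d ((f ^^ n) x) ((f ^^ n) y)) \<longlonglongrightarrow> 0"
proof (rule tendsto_sandwich[OF _ _ tendsto_const])
  show "(\<lambda>n. (\<phi> ^^ n) (d x y)) \<longlonglongrightarrow> 0"
    using comparison_function_funpow_tendsto[OF assms(2)] b_metric_spaceD(3)[OF assms(1,5,6)] .
  show "\<forall>\<^sub>F n in sequentially. 0 \<le> d ((f ^^ n) x) ((f ^^ n) y)"
    using b_metric_spaceD(3)[OF assms(1) funpow_mem[OF assms(3,5)] funpow_mem[OF assms(3,6)]] by simp
  show "\<forall>\<^sub>F n in sequentially. d ((f ^^ n) x) ((f ^^ n) y) \<le> (\<phi> ^^ n) (d x y)"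
    using phi_contraction_funpow[OF assms] by simp
qed

lemma phi_contraction_orbit_near:
  assumes X: "b_metric_space X d s" and \<phi>: "comparison_function \<phi>"
    and f: "f \<in> X \<rightarrow> X" and contr: "phi_contraction X d \<phi> f" and x: "x \<in> X"
    and "0 < \<epsilon>"
  obtains K where "\<And>m. K \<le> m \<Longrightarrow> d ((f ^^ K) x) ((f ^^ m) x) \<le> \<epsilon>"
proof -
  define y where "y k = (f ^^ k) x" for k
  have y: "y k \<in> X" for k
    unfolding y_def using funpow_mem[OF f x] .
  have s: "1 \<le> s" using b_metric_spaceD(2)[OF X] .
  \<comment> \<open>Two legs of length at most \<delta> give exactly \<epsilon> after multiplication
    by \<open>s\<close>.\<close>
  define \<delta> where "\<delta> = \<epsilon> / (2 * s)"
  have \<delta>: "0 < \<delta>" "\<delta> \<le> \<epsilon>" and s\<delta>: "s * (\<delta> + \<delta>) = \<epsilon>"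
    using \<open>0 < \<epsilon>\<close> s by (auto simp: \<delta>_def field_simps)
  have "\<forall>\<^sub>F n in sequentially. (\<phi> ^^ n) \<epsilon> < \<delta>"
    using comparison_function_funpow_tendsto[OF \<phi>, of \<epsilon>] \<open>0 < \<epsilon>\<close> \<delta>(1)
    by (intro order_tendstoD) auto
  \<comment> \<open>Positivity of \<open>n\<close> makes \<open>m - n\<close> smaller than
    \<open>m\<close> in the induction below.\<close>
  then obtain n where "(\<phi> ^^ n) \<epsilon> < \<delta>" "0 < n"
    using eventually_conj[OF _ eventually_gt_at_top[of 0]] eventually_happens
    by (metis (mono_tags, lifting) trivial_limit_sequentially)
  \<comment> \<open>Since \<open>y (k + r)\<close> is the \<open>k\<close>-th iterate of
    \<open>y r\<close>, this compares the orbits of \<open>x\<close> and \<open>y r\<close>.\<close>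
  have gap: "\<forall>\<^sub>F k in sequentially. d (y k) (y (k + r)) < \<delta>" for r
    using phi_contraction_funpow_tendsto[OF X \<phi> f contr x y[of r]] \<delta>(1)
    by (intro order_tendstoD(2)[of _ 0]) (simp_all add: y_def funpow_add)
  \<comment> \<open>Only finitely many \<open>r\<close> occur, so one \<open>K\<close> serves them
    all. The value \<open>r = n\<close> is included because it bounds the first leg, from
    \<open>y K\<close> to \<open>y (K + n)\<close>.\<close>
  have "\<forall>\<^sub>F k in sequentially. \<forall>r\<in>{..n}. d (y k) (y (k + r)) < \<delta>"
    by (intro eventually_ball_finite) (use gap in auto)
  then obtain K where K: "\<And>r. r \<le> n \<Longrightarrow> d (y K) (y (K + r)) < \<delta>"
    by (auto simp: eventually_sequentially)
  have "d (y K) (y m) \<le> \<epsilon>" if "K \<le> m" for m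
    using that
  proof (induction m rule: less_induct)
    case (less m)
    show ?case
    proof (cases "m \<le> K + n")
      case True
      then have "d (y K) (y m) < \<delta>"
        using K[of "m - K"] less.prems by simp
      then show ?thesis using \<delta>(2) by simp
    next
      case False
      define m' where "m' = m - n"
      have m': "m = n + m'" "K \<le> m'" "m' < m"
        using False \<open>0 < n\<close> by (auto simp: m'_def)
      \<comment> \<open>The \<open>n\<close>-th iterate of \<open>f\<close> carries
        \<open>y K\<close> and \<open>y m'\<close> to \<open>y (K + n)\<close> and
        \<open>y m\<close>, so the induction hypothesis for \<open>m'\<close> controls the second
        leg.\<close>
      have "d (y (K + n)) (y m) \<le> (\<phi> ^^ n) (d (y K) (y m'))"
        using phi_contraction_funpow[OF X \<phi> f contr y y, of n K m']
        by (simp add: y_def m'(1) funpow_add add.commute[of K])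
      also have "\<dots> \<le> (\<phi> ^^ n) \<epsilon>"
        using comparison_function_funpow_mono[OF \<phi>] b_metric_spaceD(3)[OF X y y]
          less.IH[OF m'(3,2)] by blast
      finally have "d (y (K + n)) (y m) \<le> \<delta>"
        using \<open>(\<phi> ^^ n) \<epsilon> < \<delta>\<close> by simp
      then have "s * (d (y K) (y (K + n)) + d (y (K + n)) (y m)) \<le> s * (\<delta> + \<delta>)"
        using K[of n] s by (intro mult_left_mono) auto
      then show ?thesis
        using b_metric_spaceD(6)[OF X y y y, of K m "K + n"] s\<delta> by simp
    qed
  qed
  then show thesis using that unfolding y_def by blast
qed

text \<open>Any two points of the tail are compared through the common centre given by the preceding
  lemma.\<close>

lemma phi_contraction_orbit_Cauchy:
  assumes X: "b_metric_space X d s" and \<phi>: "comparison_function \<phi>"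
    and f: "f \<in> X \<rightarrow> X" and contr: "phi_contraction X d \<phi> f" and x: "x \<in> X"
  shows "b_Cauchy d (\<lambda>n. (f ^^ n) x)"
  unfolding b_Cauchy_def
proof (intro allI impI)
  fix \<epsilon> :: real
  assume "0 < \<epsilon>"
  have s: "1 \<le> s" using b_metric_spaceD(2)[OF X] .
  \<comment> \<open>The factor 4 makes \<open>s * (\<delta> + \<delta>)\<close> equal to half of
    \<epsilon>, which turns the weak bound into the strict one.\<close>
  define \<delta> where "\<delta> = \<epsilon> / (4 * s)"
  have \<delta>: "0 < \<delta>" and s\<delta>: "s * (\<delta> + \<delta>) < \<epsilon>"
    using \<open>0 < \<epsilon>\<close> s by (auto simp: \<delta>_def field_simps)
  obtain K where K: "\<And>m. K \<le> m \<Longrightarrow> d ((f ^^ K) x) ((f ^^ m) x) \<le> \<delta>"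
    using phi_contraction_orbit_near[OF X \<phi> f contr x \<delta>] by blast
  have "d ((f ^^ m) x) ((f ^^ n) x) < \<epsilon>" if "K \<le> m" "K \<le> n" for m n
  proof -
    note mem = funpow_mem[OF f x]
    have "d ((f ^^ m) x) ((f ^^ n) x)
        \<le> s * (d ((f ^^ K) x) ((f ^^ m) x) + d ((f ^^ K) x) ((f ^^ n) x))"
      using b_metric_spaceD(6)[OF X mem mem mem, of m n K]
        b_metric_spaceD(5)[OF X mem mem, of m K] by simp
    also have "\<dots> \<le> s * (\<delta> + \<delta>)"
      using K that s by (intro mult_left_mono add_mono) auto
    finally show ?thesis using s\<delta> by simp
  qed
  then show "\<exists>N. \<forall>m\<ge>N. \<forall>n\<ge>N. d ((f ^^ m) x) ((f ^^ n) x) < \<epsilon>" by blast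
qed

text \<open>As \<open>d\<close> may be discontinuous, no limit is taken inside it: the constant
  \<open>d (f \<alpha>) \<alpha>\<close> is bounded, for each \<open>n\<close>, by a multiple of
  distances from the orbit to \<alpha>, which tend to 0.\<close>

lemma phi_contraction_limit_fixed:
  assumes X: "b_metric_space X d s" and \<phi>: "comparison_function \<phi>"
    and f: "f \<in> X \<rightarrow> X" and contr: "phi_contraction X d \<phi> f" and x: "x \<in> X"
    and conv: "b_converges_to X d (\<lambda>n. (f ^^ n) x) \<alpha>"
  shows "f \<alpha> = \<alpha>"
proof -
  define y where "y n = (f ^^ n) x" for n
  have y: "y n \<in> X" for n
    unfolding y_def using funpow_mem[OF f x] .
  have \<alpha>: "\<alpha> \<in> X" and lim: "(\<lambda>n. d (y n) \<alpha>) \<longlonglongrightarrow> 0"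
    using conv unfolding b_converges_to_def y_def by auto
  have f\<alpha>: "f \<alpha> \<in> X" using f \<alpha> by auto
  have bound: "d (f \<alpha>) \<alpha> \<le> s * (d (y n) \<alpha> + d (y (Suc n)) \<alpha>)" for n
  proof -
    have "d (f \<alpha>) (y (Suc n)) \<le> \<phi> (d \<alpha> (y n))"
      using contr \<alpha> y[of n] unfolding phi_contraction_def by (simp add: y_def)
    also have "\<dots> \<le> d \<alpha> (y n)"
      using comparison_function_le[OF \<phi> b_metric_spaceD(3)[OF X \<alpha> y]] .
    also have "\<dots> = d (y n) \<alpha>"
      using b_metric_spaceD(5)[OF X \<alpha> y] .
    finally have "s * (d (f \<alpha>) (y (Suc n)) + d (y (Suc n)) \<alpha>)
        \<le> s * (d (y n) \<alpha> + d (y (Suc n)) \<alpha>)"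
      using b_metric_spaceD(2)[OF X] by (intro mult_left_mono add_right_mono) auto
    then show ?thesis
      using b_metric_spaceD(6)[OF X f\<alpha> \<alpha> y[of "Suc n"]] by simp
  qed
  have "(\<lambda>n. s * (d (y n) \<alpha> + d (y (Suc n)) \<alpha>)) \<longlonglongrightarrow> s * (0 + 0)"
    by (intro tendsto_intros lim LIMSEQ_Suc[OF lim])
  then have "d (f \<alpha>) \<alpha> \<le> s * (0 + 0)"
    by (rule LIMSEQ_le_const) (use bound in blast)
  then have "d (f \<alpha>) \<alpha> = 0"
    using b_metric_spaceD(3)[OF X f\<alpha> \<alpha>] by simp
  then show ?thesis
    using b_metric_spaceD(4)[OF X f\<alpha> \<alpha>] by simp
qed

theorem corollary3p1:
  fixes X :: "'a set" and d :: "'a \<Rightarrow> 'a \<Rightarrow> real" and s :: real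
    and \<phi> :: "real \<Rightarrow> real" and f :: "'a \<Rightarrow> 'a"
  assumes "b_metric_space X d s"
    and "b_complete X d"
    and "comparison_function \<phi>"
    and "f \<in> X \<rightarrow> X"
    and "phi_contraction X d \<phi> f"
  shows "Picard_operator X d f"
proof -
  note hyps = assms(1,3-5)
  obtain x where x: "x \<in> X"
    using b_metric_spaceD(1)[OF assms(1)] by blast
  obtain \<alpha> where conv: "b_converges_to X d (\<lambda>n. (f ^^ n) x) \<alpha>"
    using assms(2)[unfolded b_complete_def, rule_format, of "\<lambda>n. (f ^^ n) x"]
      phi_contraction_orbit_Cauchy[OF hyps x] funpow_mem[OF assms(4) x] by blast
  have \<alpha>: "\<alpha> \<in> X" using conv unfolding b_converges_to_def by simp
  have funpow_fixed: "(f ^^ n) \<beta> = \<beta>" if "f \<beta> = \<beta>" for n \<beta>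
    using that by (induction n) auto
  have fixed: "f \<alpha> = \<alpha>"
    using phi_contraction_limit_fixed[OF hyps x conv] .
  \<comment> \<open>The orbit of \<alpha> is constant, and any two orbits approach each
    other.\<close>
  have tendsto: "(\<lambda>n. d ((f ^^ n) z) \<alpha>) \<longlonglongrightarrow> 0" if "z \<in> X" for z
    using phi_contraction_funpow_tendsto[OF hyps that \<alpha>] by (simp add: funpow_fixed[OF fixed])
  \<comment> \<open>The orbit of \<beta> is constant too, so the constant
    \<open>d \<beta> \<alpha>\<close> has limit 0.\<close>
  have "\<beta> = \<alpha>" if "\<beta> \<in> X" "f \<beta> = \<beta>" for \<beta>
    using tendsto[OF that(1)] b_metric_spaceD(4)[OF assms(1) that(1) \<alpha>]
    by (simp add: funpow_fixed[OF that(2)] LIMSEQ_const_iff)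
  then show ?thesis
    unfolding Picard_operator_def b_converges_to_def using \<alpha> fixed tendsto by blast
qed

end
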